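(* Let $\mathbf{y}=\mathbf{G}\mathbf{u}+\mathbf{y}_0+\Theta\mathbf{e}$ be the true stacked system, let $\hat{\mathbf{G}}$ be a nominal approximation of $\mathbf{G}$, and let $\Delta:=\mathbf{G}-\hat{\mathbf{G}}$. Let $\hat\Phi_y$ (block-lower-triangular), $\hat\Phi_u$ (block strictly-lower-triangular), $\hat\phi_y$, $\hat\phi_u$ satisfy $$\begin{bmatrix} I & -\hat{\mathbf{G}}\end{bmatrix}\begin{bmatrix}\hat\Phi_y&\hat\phi_y\\ \hat\Phi_u&\hat\phi_u\end{bmatrix}=\begin{bmatrix} I & 0\end{bmatrix},$$ and apply to the true system the control law $\mathbf{u}=\mathbf{K}\mathbf{y}+\mathbf{p}$ with $\mathbf{K}=\hat\Phi_u\hat\Phi_y^{-1}$ and $\mathbf{p}=\hat\phi_u-\mathbf{K}\hat\phi_y$. Then the true closed-loop response $\bm{\eta}:=\mathrm{col}(\mathbf{y},\mathbf{u})$ is $$\bm{\eta}=\Phi(\mathbf{y}_0+\Theta\mathbf{e})+\phi,$$ where the true closed-loop response parameterization $\{\Phi_y,\Phi_u,\phi_y,\phi_u\}$ is given by $$\Phi:=\begin{bmatrix}\Phi_y\\ \Phi_u\end{bmatrix}=\begin{bmatrix}\hat\Phi_y\\ \hat\Phi_u\end{bmatrix}(I-\Delta\hat\Phi_u)^{-1},$$ $$\phi:=\begin{bmatrix}\phi_y\\ \phi_u\end{bmatrix}=\begin{bmatrix} I & \hat\Phi_y(I-\Delta\hat\Phi_u)^{-1}\Delta\\ 0 & I+\hat\Phi_u(I-\Delta\hat\Phi_u)^{-1}\Delta\end{bmatrix}\begin{bmatrix}\hat\phi_y\\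 \hat\phi_u\end{bmatrix}.$$
   Context: Setting: the system $x_{t+1}=Ax_t+Bu_t+Le_t$, $y_t=Cx_t+Du_t+e_t$ with $x_t\in\mathbb{R}^n$, $u_t\in\mathbb{R}^m$, $y_t,e_t\in\mathbb{R}^q$, over $t=0,\dots,T$, is represented by $\mathbf{y}=\mathbf{G}\mathbf{u}+\mathbf{y}_0+\Theta\mathbf{e}$, with $\mathbf{y}=\mathrm{col}(y_0,\dots,y_T)$, $\mathbf{u}=\mathrm{col}(u_0,\dots,u_T)$, $\mathbf{e}=\mathrm{col}(e_0,\dots,e_T)$ and $\mathbf{e}\in\mathbb{R}^{q(T+1)}$ arbitrary. Here $\mathbf{C}=\mathrm{blkdiag}(C,\dots,C)$, $\mathbf{D}=\mathrm{blkdiag}(D,\dots,D)$ ($T+1$ copies), $\mathbf{T}_u$ (resp. $\mathbf{T}_e$) has $(i,j)$ block $A^{i-j-1}B$ (resp. $A^{i-j-1}L$) for $i>j$ and $0$ otherwise, $0\le i,j\le T$; $\mathbf{G}=\mathbf{C}\mathbf{T}_u+\mathbf{D}$ (block-lower-triangular), $\Theta=\mathbf{C}\mathbf{T}_e+I$, and $\mathbf{y}_0\in\mathbb{R}^{q(T+1)}$ is a fixed vector determined by past input-output data (the predicted output due to the initial state, $\mathbf{y}_0 = \mathbf{C}\,\mathrm{col}(I,A,\dots,A^T)\,\Psi\,\mathrm{col}(\mathbf{u}_0^-,\mathbf{y}_0^-)$ with past data $\mathbf{u}_0^-=\mathrm{col}(u_{-\tau},\dots,u_{-1})$, $\mathbf{y}_0^-=\mathrm{col}(y_{-\tau},\dots,y_{-1})$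 and $\Psi=[\Psi^u_\tau,\dots,\Psi^u_1,\Psi^y_\tau,\dots,\Psi^y_1]$, $\Psi^u_k=(A-LC)^{k-1}(B-LD)$, $\Psi^y_k=(A-LC)^{k-1}L$; the truncation error for the past horizon $\tau$ is neglected). All matrices are partitioned into $(T+1)\times(T+1)$ blocks (size $q$ for output coordinates, $m$ for input coordinates). Block-lower-triangular: $(i,j)$ block zero for $j>i$; block strictly-lower-triangular: zero for $j\ge i$. The nominal $\hat{\mathbf{G}}\in\mathbb{R}^{q(T+1)\times m(T+1)}$ is block-lower-triangular, like $\mathbf{G}$, so $\Delta$ is too. Sizes: $\hat\Phi_y\in\mathbb{R}^{q(T+1)\times q(T+1)}$, $\hat\Phi_u\in\mathbb{R}^{m(T+1)\times q(T+1)}$, $\hat\phi_y\in\mathbb{R}^{q(T+1)}$, $\hat\phi_u\in\mathbb{R}^{m(T+1)}$. The true closed-loop response is the unique $(\mathbf{y},\mathbf{u})$ satisfying $\mathbf{y}=\mathbf{G}\mathbf{u}+\mathbf{y}_0+\Theta\mathbf{e}$ and $\mathbf{u}=\mathbf{K}\mathbf{y}+\mathbf{p}$, for each $\mathbf{e}$. *)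

theory Defs
  imports "Jordan_Normal_Form.Gauss_Jordan_Elimination"
begin

(* Block indices start at 0, so a horizon t = 0..T gives T + 1 blocks. A vector col(v_0,...,v_T)
   with v_t in R^d is an element of carrier_vec (d * (T + 1)). *)

definition block_matrix ::
  "nat \<Rightarrow> nat \<Rightarrow> nat \<Rightarrow> nat \<Rightarrow> (nat \<Rightarrow> nat \<Rightarrow> real mat) \<Rightarrow> real mat" where
  "block_matrix M N r c F =
     mat (r * M) (c * N) (\<lambda>(a, b). F (a div r) (b div c) $$ (a mod r, b mod c))"

definition block :: "nat \<Rightarrow> nat \<Rightarrow> real mat \<Rightarrow> nat \<Rightarrow> nat \<Rightarrow> real mat" where
  "block r c X i j = mat r c (\<lambda>(a, b). X $$ (i * r + a, j * c + b))"

definition block_lower_triangular :: "nat \<Rightarrow> nat \<Rightarrow> nat \<Rightarrow> real mat \<Rightarrow> bool" where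
  "block_lower_triangular T r c X \<longleftrightarrow>
     (\<forall>i\<le>T. \<forall>j\<le>T. j > i \<longrightarrow> block r c X i j = 0\<^sub>m r c)"

definition block_strictly_lower_triangular :: "nat \<Rightarrow> nat \<Rightarrow> nat \<Rightarrow> real mat \<Rightarrow> bool" where
  "block_strictly_lower_triangular T r c X \<longleftrightarrow>
     (\<forall>i\<le>T. \<forall>j\<le>T. j \<ge> i \<longrightarrow> block r c X i j = 0\<^sub>m r c)"

definition append_cols :: "real mat \<Rightarrow> real mat \<Rightarrow> real mat" where
  "append_cols X Y = four_block_mat X Y (0\<^sub>m 0 (dim_col X)) (0\<^sub>m 0 (dim_col Y))"

definition col_mat :: "real vec \<Rightarrow> real mat" where
  "col_mat v = mat_of_cols (dim_vec v) [v]"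

(* Unspecified for singular matrices: invertibility has to be stated separately. *)
definition minv :: "real mat \<Rightarrow> real mat" where
  "minv X = the (mat_inverse X)"

definition blkdiag :: "nat \<Rightarrow> real mat \<Rightarrow> real mat" where
  "blkdiag T X = diag_block_mat (replicate (T + 1) X)"

(* The common form of T_u (with B) and T_e (with L). *)
definition stacked_T :: "nat \<Rightarrow> real mat \<Rightarrow> real mat \<Rightarrow> real mat" where
  "stacked_T T A B = block_matrix (T + 1) (T + 1) (dim_row B) (dim_col B)
     (\<lambda>i j. if i > j then (A ^\<^sub>m (i - j - 1)) * B else 0\<^sub>m (dim_row B) (dim_col B))"

definition stacked_G :: "nat \<Rightarrow> real mat \<Rightarrow> real mat \<Rightarrow> real mat \<Rightarrow> real mat \<Rightarrow> real mat" where
  "stacked_G T A B C D = blkdiag T C * stacked_T T A B + blkdiag T D"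

definition stacked_Theta :: "nat \<Rightarrow> real mat \<Rightarrow> real mat \<Rightarrow> real mat \<Rightarrow> real mat" where
  "stacked_Theta T A C L = blkdiag T C * stacked_T T A L + 1\<^sub>m (dim_row C * (T + 1))"

definition stacked_powers :: "nat \<Rightarrow> real mat \<Rightarrow> real mat" where
  "stacked_powers T A = block_matrix (T + 1) 1 (dim_row A) (dim_col A) (\<lambda>i j. A ^\<^sub>m i)"

definition Psi_u ::
  "real mat \<Rightarrow> real mat \<Rightarrow> real mat \<Rightarrow> real mat \<Rightarrow> real mat \<Rightarrow> nat \<Rightarrow> real mat" where
  "Psi_u A B C D L k = ((A - L * C) ^\<^sub>m (k - 1)) * (B - L * D)"

definition Psi_y :: "real mat \<Rightarrow> real mat \<Rightarrow> real mat \<Rightarrow> nat \<Rightarrow> real mat" where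
  "Psi_y A C L k = ((A - L * C) ^\<^sub>m (k - 1)) * L"

(* Block columns run k = tau, ..., 1, matching past data ordered t = -tau, ..., -1. *)
definition Psi ::
  "nat \<Rightarrow> real mat \<Rightarrow> real mat \<Rightarrow> real mat \<Rightarrow> real mat \<Rightarrow> real mat \<Rightarrow> real mat" where
  "Psi \<tau> A B C D L = append_cols
     (block_matrix 1 \<tau> (dim_row B) (dim_col B) (\<lambda>i j. Psi_u A B C D L (\<tau> - j)))
     (block_matrix 1 \<tau> (dim_row L) (dim_col L) (\<lambda>i j. Psi_y A C L (\<tau> - j)))"

definition predicted_output ::
  "nat \<Rightarrow> nat \<Rightarrow> real mat \<Rightarrow> real mat \<Rightarrow> real mat \<Rightarrow> real mat \<Rightarrow> real mat
   \<Rightarrow> real vec \<Rightarrow> real vec \<Rightarrow> real vec" where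
  "predicted_output T \<tau> A B C D L u_past y_past =
     (blkdiag T C * stacked_powers T A * Psi \<tau> A B C D L) *\<^sub>v (u_past @\<^sub>v y_past)"

definition closed_loop_response ::
  "real mat \<Rightarrow> real vec \<Rightarrow> real mat \<Rightarrow> real mat \<Rightarrow> real vec \<Rightarrow> real vec
   \<Rightarrow> real vec \<Rightarrow> real vec \<Rightarrow> bool" where
  "closed_loop_response G y0 \<Theta> K p e y u \<longleftrightarrow>
     y \<in> carrier_vec (dim_row G) \<and> u \<in> carrier_vec (dim_col G) \<and>
     y = G *\<^sub>v u + y0 + \<Theta> *\<^sub>v e \<and> u = K *\<^sub>v y + p"

end

theory Submission
  imports Defs "Jordan_Normal_Form.Determinant"
begin

text \<open>Achievability says \<open>\<Phi>hy = 1 + Gh * \<Phi>hu\<close> and \<open>\<phi>hy = Gh *\<^sub>v \<phi>hu\<close>. Both \<open>\<Phi>hy\<close> and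
  \<open>1 - \<Delta> * \<Phi>hu\<close> are the identity plus a block strictly lower triangular matrix, hence of
  determinant one. Substituting \<open>y = \<Phi>hy *\<^sub>v z + \<phi>hy\<close>, the control law becomes
  \<open>u = \<Phi>hu *\<^sub>v z + \<phi>hu\<close> and the system equation collapses to
  \<open>(1 - \<Delta> * \<Phi>hu) *\<^sub>v z = y0 + \<Theta> *\<^sub>v e + \<Delta> *\<^sub>v \<phi>hu\<close>, which determines \<open>z\<close>.\<close>

section \<open>Inverses and unit determinants\<close>

lemma minv_inverse:
  assumes X: "X \<in> carrier_mat n n" and det: "det X \<noteq> 0"
  shows "minv X \<in> carrier_mat n n" "X * minv X = 1\<^sub>m n" "minv X * X = 1\<^sub>m n"
proof -
  \<comment> \<open>\<open>mat_inverse\<close> returns \<open>None\<close> only for non-units of the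
    matrix ring, so a nonzero determinant makes \<open>minv X\<close> a genuine inverse rather than
    \<open>the None\<close>.\<close>
  have "X \<in> Units (ring_mat TYPE(real) n ())"
    by (rule det_non_zero_imp_unit[OF X det])
  with mat_inverse(1)[OF X, of "()"] obtain Y where Y: "mat_inverse X = Some Y"
    by (cases "mat_inverse X") auto
  with mat_inverse(2)[OF X Y]
  show "minv X \<in> carrier_mat n n" "X * minv X = 1\<^sub>m n" "minv X * X = 1\<^sub>m n"
    by (simp_all add: minv_def)
qed

lemma invertible_mat_if_det_nonzero:
  fixes X :: "real mat"
  assumes X: "X \<in> carrier_mat n n" and det: "det X \<noteq> 0"
  shows "invertible_mat X"
  using minv_inverse[OF assms] X unfolding invertible_mat_def inverts_mat_def by auto

text \<open>Division by \<open>r\<close> is monotone, so \<open>a \<le> b\<close> implies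
  \<open>a div r \<le> b div r\<close>: block strict lower triangularity with equal row and column
  block sizes gives entrywise strict lower triangularity. The sum then has a unit diagonal.\<close>

lemma det_one_plus_block_strictly_lower:
  fixes X :: "real mat"
  assumes X: "X \<in> carrier_mat n n"
    and zero: "\<And>a b. a < n \<Longrightarrow> b < n \<Longrightarrow> a div r \<le> b div r \<Longrightarrow> X $$ (a, b) = 0"
  shows "det (1\<^sub>m n + X) = 1"
proof -
  have upper: "X $$ (a, b) = 0" if "a \<le> b" "b < n" for a b
    using that by (intro zero div_le_mono) auto
  have "det (1\<^sub>m n + X) = prod_list (diag_mat (1\<^sub>m n + X))"
    by (rule det_lower_triangular[of n]) (use X upper in auto)
  also have "diag_mat (1\<^sub>m n + X) = map (\<lambda>i. 1) [0..<n]"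
    unfolding diag_mat_def using X upper by auto
  finally show ?thesis
    by (simp add: map_replicate_const)
qed

section \<open>Block zero patterns in terms of entries\<close>

lemma block_eq_zero_entry:
  assumes zero: "a div r \<le> T \<Longrightarrow> b div c \<le> T \<Longrightarrow> block r c X (a div r) (b div c) = 0\<^sub>m r c"
    and a: "a < r * (T + 1)" and b: "b < c * (T + 1)"
  shows "X $$ (a, b) = 0"
proof -
  \<comment> \<open>An index below \<open>r * (T + 1)\<close> forces \<open>r > 0\<close>, hence
    \<open>a mod r < r\<close>, and likewise for \<open>b\<close>; so the entry is addressed inside
    its block.\<close>
  have pos: "r > 0" "c > 0" using a b by (auto intro: gr0I)
  have "a div r \<le> T" "b div c \<le> T"
    using a b by (simp_all add: less_mult_imp_div_less mult.commute flip: less_Suc_eq_le)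
  then have "block r c X (a div r) (b div c) $$ (a mod r, b mod c) = 0"
    using zero pos by simp
  then show ?thesis
    using pos by (simp add: block_def)
qed

lemma block_lower_triangular_entry:
  assumes "block_lower_triangular T r c X"
    and "a < r * (T + 1)" "b < c * (T + 1)" "a div r < b div c"
  shows "X $$ (a, b) = 0"
  by (rule block_eq_zero_entry[of a r T b c])
    (use assms in \<open>auto simp: block_lower_triangular_def\<close>)

lemma block_strictly_lower_triangular_entry:
  assumes "block_strictly_lower_triangular T r c X"
    and "a < r * (T + 1)" "b < c * (T + 1)" "a div r \<le> b div c"
  shows "X $$ (a, b) = 0"
  by (rule block_eq_zero_entry[of a r T b c])
    (use assms in \<open>auto simp: block_strictly_lower_triangular_def\<close>)

text \<open>Every summand vanishes: either the block of \<open>k\<close> lies beyond the block row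
  of \<open>a\<close> and the left factor is zero, or
  \<open>k div c \<le> a div r \<le> b div s\<close> and the right factor is zero.\<close>

lemma mult_block_lower_block_strictly_lower_entry:
  fixes X Y :: "real mat"
  assumes X: "X \<in> carrier_mat nr n" and Y: "Y \<in> carrier_mat n nc"
    and X0: "\<And>a k. a < nr \<Longrightarrow> k < n \<Longrightarrow> a div r < k div c \<Longrightarrow> X $$ (a, k) = 0"
    and Y0: "\<And>k b. k < n \<Longrightarrow> b < nc \<Longrightarrow> k div c \<le> b div s \<Longrightarrow> Y $$ (k, b) = 0"
    and a: "a < nr" and b: "b < nc" and le: "a div r \<le> b div s"
  shows "(X * Y) $$ (a, b) = 0"
proof -
  have "X $$ (a, k) * Y $$ (k, b) = 0" if "k < n" for k
    using X0[OF a that] Y0[OF that b] le by (cases "a div r < k div c") auto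
  then show ?thesis
    using X Y a b by (auto simp: scalar_prod_def intro!: sum.neutral simp del: mult_eq_0_iff)
qed

section \<open>Causality of the stacked system\<close>

lemma diag_block_mat_replicate_entry:
  assumes "a < dim_row X * k" "b < dim_col X * k" "a div dim_row X \<noteq> b div dim_col X"
  shows "diag_block_mat (replicate k X) $$ (a, b) = 0"
  using assms
proof (induction k arbitrary: a b)
  case (Suc k)
  have pos: "dim_row X > 0" "dim_col X > 0" using Suc.prems by (auto intro: gr0I)
  show ?case
  \<comment> \<open>As the block indices differ, in the first case exactly one index falls in the
    leading block's range, and the entry lies in a zero off-diagonal block. Otherwise removing the
    leading block lowers both block indices by one, which keeps them different.\<close>
  proof (cases "a < dim_row X \<or> b < dim_col X")
    case True
    then show ?thesis
      using Suc.prems by (auto simp: Let_def dim_diag_block_mat sum_list_replicate mult.commute)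
  next
    case False
    then have "(a - dim_row X) div dim_row X \<noteq> (b - dim_col X) div dim_col X"
      using Suc.prems(3) pos by (simp add: le_div_geq)
    then show ?thesis
      using Suc.IH[of "a - dim_row X" "b - dim_col X"] Suc.prems False
      by (auto simp: Let_def dim_diag_block_mat sum_list_replicate mult.commute)
  qed
qed simp

lemma blkdiag_carrier: "blkdiag T X \<in> carrier_mat (dim_row X * (T + 1)) (dim_col X * (T + 1))"
  by (rule carrier_matI) (simp_all add: blkdiag_def dim_diag_block_mat sum_list_replicate mult.commute)

lemma blkdiag_entry:
  assumes "a < dim_row X * (T + 1)" "b < dim_col X * (T + 1)" "a div dim_row X \<noteq> b div dim_col X"
  shows "blkdiag T X $$ (a, b) = 0"
  unfolding blkdiag_def by (rule diag_block_mat_replicate_entry) (use assms in auto)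

lemma stacked_T_carrier:
  "stacked_T T A B \<in> carrier_mat (dim_row B * (T + 1)) (dim_col B * (T + 1))"
  by (simp add: stacked_T_def block_matrix_def)

lemma stacked_T_entry:
  assumes "k < dim_row B * (T + 1)" "b < dim_col B * (T + 1)" "k div dim_row B \<le> b div dim_col B"
  shows "stacked_T T A B $$ (k, b) = 0"
proof -
  have "dim_row B > 0" "dim_col B > 0" using assms by (auto intro: gr0I)
  then show ?thesis
    using assms by (simp add: stacked_T_def block_matrix_def)
qed

lemma stacked_G_carrier:
  assumes "B \<in> carrier_mat n m" "C \<in> carrier_mat q n" "D \<in> carrier_mat q m"
  shows "stacked_G T A B C D \<in> carrier_mat (q * (T + 1)) (m * (T + 1))"
  using assms blkdiag_carrier[of T D] by (simp add: stacked_G_def)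

text \<open>The block diagonal \<open>blkdiag T C\<close> preserves the strict block triangularity
  of \<open>stacked_T T A B\<close>; the feedthrough \<open>blkdiag T D\<close> adds only diagonal
  blocks.\<close>

lemma stacked_G_entry:
  assumes B: "B \<in> carrier_mat n m" and C: "C \<in> carrier_mat q n" and D: "D \<in> carrier_mat q m"
    and a: "a < q * (T + 1)" and b: "b < m * (T + 1)" and lt: "a div q < b div m"
  shows "stacked_G T A B C D $$ (a, b) = 0"
proof -
  have dims: "dim_row B = n" "dim_col B = m" "dim_row C = q" "dim_col C = n" "dim_row D = q"
    "dim_col D = m" using B C D by auto
  have "(blkdiag T C * stacked_T T A B) $$ (a, b) = 0"
  proof (rule mult_block_lower_block_strictly_lower_entry[where r = q and c = n and s = m])
    show "blkdiag T C \<in> carrier_mat (q * (T + 1)) (n * (T + 1))"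
      using blkdiag_carrier[of T C] dims by simp
    show "stacked_T T A B \<in> carrier_mat (n * (T + 1)) (m * (T + 1))"
      using stacked_T_carrier[of T A B] dims by simp
  qed (use a b lt dims blkdiag_entry[of _ C T] stacked_T_entry[of _ B T] in auto)
  moreover have "blkdiag T D $$ (a, b) = 0"
    using blkdiag_entry[of a D T b] a b lt dims by simp
  moreover have "blkdiag T D \<in> carrier_mat (q * (T + 1)) (m * (T + 1))"
    using blkdiag_carrier[of T D] dims by simp
  ultimately show ?thesis
    using a b by (simp add: stacked_G_def)
qed

section \<open>Achievability and the closed loop as linear equations\<close>

lemma achievability_iff:
  assumes Gh: "Gh \<in> carrier_mat N M"
    and Py: "Py \<in> carrier_mat N N" and Pu: "Pu \<in> carrier_mat M N"
    and fy: "fy \<in> carrier_vec N" and fu: "fu \<in> carrier_vec M"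
  shows "append_cols (1\<^sub>m N) (- Gh) * four_block_mat Py (col_mat fy) Pu (col_mat fu)
      = append_cols (1\<^sub>m N) (0\<^sub>m N 1) \<longleftrightarrow> Py = 1\<^sub>m N + Gh * Pu \<and> fy = Gh *\<^sub>v fu"
proof -
  have fyc: "col_mat fy \<in> carrier_mat N 1" and fuc: "col_mat fu \<in> carrier_mat M 1"
    using fy fu by (auto simp: col_mat_def)
  \<comment> \<open>\<open>append_cols\<close> is a four-block matrix whose lower blocks have no
    rows, so the block product formula applies with lower height \<open>0\<close>.\<close>
  have "append_cols (1\<^sub>m N) (- Gh) * four_block_mat Py (col_mat fy) Pu (col_mat fu)
      = append_cols (1\<^sub>m N * Py + (- Gh) * Pu) (1\<^sub>m N * col_mat fy + (- Gh) * col_mat fu)"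
    unfolding append_cols_def
    by (subst mult_four_block_mat[of _ N N _ M _ 0 _ _ N _ 1]) (use Gh Py Pu fyc fuc in auto)
  also have "\<dots> = append_cols (Py - Gh * Pu) (col_mat fy - Gh * col_mat fu)"
    using Gh Py Pu fyc fuc by (simp add: minus_add_uminus_mat[of _ N])
  also have "\<dots> = append_cols (1\<^sub>m N) (0\<^sub>m N 1)
      \<longleftrightarrow> Py - Gh * Pu = 1\<^sub>m N \<and> col_mat fy - Gh * col_mat fu = 0\<^sub>m N 1"
  proof
    assume eq: "append_cols (Py - Gh * Pu) (col_mat fy - Gh * col_mat fu)
      = append_cols (1\<^sub>m N) (0\<^sub>m N 1)"
    have ent: "append_cols (Py - Gh * Pu) (col_mat fy - Gh * col_mat fu) $$ (i, j)
      = append_cols (1\<^sub>m N) (0\<^sub>m N 1) $$ (i, j)" for i j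
      using eq by simp
    show "Py - Gh * Pu = 1\<^sub>m N \<and> col_mat fy - Gh * col_mat fu = 0\<^sub>m N 1"
    proof (intro conjI eq_matI)
      fix i j assume "i < dim_row (1\<^sub>m N)" "j < dim_col (1\<^sub>m N)"
      then show "(Py - Gh * Pu) $$ (i, j) = 1\<^sub>m N $$ (i, j)"
        using ent[of i j] Gh Py Pu fyc fuc by (simp add: append_cols_def)
    next
      \<comment> \<open>The second block starts at column \<open>N\<close>, so its column
        \<open>j\<close> is column \<open>N + j\<close> of the joined matrix.\<close>
      fix i j assume "i < dim_row (0\<^sub>m N 1)" "j < dim_col (0\<^sub>m N 1)"
      then show "(col_mat fy - Gh * col_mat fu) $$ (i, j) = 0\<^sub>m N 1 $$ (i, j)"
        using ent[of i "N + j"] Gh Py Pu fyc fuc by (simp add: append_cols_def)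
    qed (use Gh Py Pu fyc fuc in auto)
  qed simp
  also have "Py - Gh * Pu = 1\<^sub>m N \<longleftrightarrow> Py = 1\<^sub>m N + Gh * Pu"
    using Gh Py Pu by (auto simp: mat_eq_iff algebra_simps)
  also have "col_mat fy - Gh * col_mat fu = 0\<^sub>m N 1 \<longleftrightarrow> fy = Gh *\<^sub>v fu"
    using Gh fy fu by (auto simp: mat_eq_iff vec_eq_iff col_mat_def mat_of_cols_index)
  finally show ?thesis .
qed

text \<open>The equivalence provides existence from right to left and uniqueness from left to right.
  Causality enters as the two nonzero determinants, and \<open>w\<close> stands for the exogenous
  term \<open>y0 + \<Theta> *\<^sub>v e\<close>.\<close>

lemma closed_loop_iff:
  fixes \<Delta> :: "real mat"
  assumes Gh: "Gh \<in> carrier_mat N M" and De: "\<Delta> \<in> carrier_mat N M"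
    and Py: "Py \<in> carrier_mat N N" and Pu: "Pu \<in> carrier_mat M N"
    and fy: "fy \<in> carrier_vec N" and fu: "fu \<in> carrier_vec M"
    and w: "w \<in> carrier_vec N"
    and y: "y \<in> carrier_vec N" and u: "u \<in> carrier_vec M"
    and Py_eq: "Py = 1\<^sub>m N + Gh * Pu" and fy_eq: "fy = Gh *\<^sub>v fu"
    and detPy: "det Py \<noteq> 0" and detR: "det (1\<^sub>m N - \<Delta> * Pu) \<noteq> 0"
    and K: "K = Pu * minv Py" and p: "p = fu - K *\<^sub>v fy"
    and z: "z = minv (1\<^sub>m N - \<Delta> * Pu) *\<^sub>v (w + \<Delta> *\<^sub>v fu)"
  shows "y = (Gh + \<Delta>) *\<^sub>v u + w \<and> u = K *\<^sub>v y + p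
    \<longleftrightarrow> y = Py *\<^sub>v z + fy \<and> u = Pu *\<^sub>v z + fu"
proof -
  note Pi = minv_inverse[OF Py detPy]
  have R: "1\<^sub>m N - \<Delta> * Pu \<in> carrier_mat N N" using De Pu by auto
  note Ri = minv_inverse[OF R detR]
  have Kc: "K \<in> carrier_mat M N" unfolding K using Pu Pi by auto
  have zc: "z \<in> carrier_vec N" unfolding z using Ri De fu w by auto
  have KPy: "K *\<^sub>v (Py *\<^sub>v x) = Pu *\<^sub>v x" if x: "x \<in> carrier_vec N" for x
  proof -
    have "K *\<^sub>v (Py *\<^sub>v x) = (K * Py) *\<^sub>v x"
      using Kc Py x by simp
    also have "K * Py = Pu * (minv Py * Py)"
      unfolding K by (rule assoc_mult_mat[OF Pu Pi(1) Py])
    finally show ?thesis using Pi(3) Pu by simp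
  qed
  \<comment> \<open>The choice of \<open>p\<close> cancels the feedback
    \<open>K *\<^sub>v fy\<close> of the nominal offset, and \<open>KPy\<close> handles the
    rest.\<close>
  have control: "K *\<^sub>v (Py *\<^sub>v x + fy) + p = Pu *\<^sub>v x + fu" if x: "x \<in> carrier_vec N" for x
  proof -
    have "K *\<^sub>v (Py *\<^sub>v x + fy) + p = (Pu *\<^sub>v x + K *\<^sub>v fy) + (fu - K *\<^sub>v fy)"
      unfolding p using Kc Py x fy by (simp add: mult_add_distrib_mat_vec[of K M N] KPy)
    also have "\<dots> = Pu *\<^sub>v x + fu"
      by (rule eq_vecI) (use Pu x fu Kc fy in auto)
    finally show ?thesis .
  qed
  have system: "Py *\<^sub>v x + fy = (Gh + \<Delta>) *\<^sub>v (Pu *\<^sub>v x + fu) + w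
      \<longleftrightarrow> (1\<^sub>m N - \<Delta> * Pu) *\<^sub>v x = w + \<Delta> *\<^sub>v fu" if x: "x \<in> carrier_vec N" for x
  proof -
    \<comment> \<open>The nominal contributions \<open>g + f\<close> occur on both sides; cancelling
      them leaves \<open>x = d + h + w\<close>, in which the plant acts only through
      \<Delta>.\<close>
    define g d f h where gdfh: "g = Gh *\<^sub>v (Pu *\<^sub>v x)" "d = \<Delta> *\<^sub>v (Pu *\<^sub>v x)"
      "f = Gh *\<^sub>v fu" "h = \<Delta> *\<^sub>v fu"
    have c: "g \<in> carrier_vec N" "d \<in> carrier_vec N" "f \<in> carrier_vec N" "h \<in> carrier_vec N"
      unfolding gdfh using Gh De Pu fu x by auto
    have Pux: "Pu *\<^sub>v x \<in> carrier_vec M" using Pu x by auto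
    have GPu: "Gh * Pu \<in> carrier_mat N N" using Gh Pu by auto
    have DPu: "\<Delta> * Pu \<in> carrier_mat N N" using De Pu by auto
    have 1: "Py *\<^sub>v x + fy = (x + g) + f"
      unfolding Py_eq fy_eq gdfh using Gh Pu x
      by (simp add: add_mult_distrib_mat_vec[OF one_carrier_mat GPu x])
    have 2: "(Gh + \<Delta>) *\<^sub>v (Pu *\<^sub>v x + fu) = (g + f) + (d + h)"
      unfolding gdfh using Gh De fu Pux
      by (simp add: add_mult_distrib_mat_vec[OF Gh De] mult_add_distrib_mat_vec[OF Gh Pux fu]
          mult_add_distrib_mat_vec[OF De Pux fu])
    have 3: "(1\<^sub>m N - \<Delta> * Pu) *\<^sub>v x = x - d"
      unfolding gdfh using De Pu x
      by (simp add: minus_mult_distrib_mat_vec[OF one_carrier_mat DPu x])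
    show ?thesis
      unfolding 1 2 3 gdfh(4)[symmetric] using c x w
      by (auto simp: vec_eq_iff algebra_simps)
  qed
  have Rz: "(1\<^sub>m N - \<Delta> * Pu) *\<^sub>v x = w + \<Delta> *\<^sub>v fu \<longleftrightarrow> x = z" if x: "x \<in> carrier_vec N" for x
  proof
    assume eq: "(1\<^sub>m N - \<Delta> * Pu) *\<^sub>v x = w + \<Delta> *\<^sub>v fu"
    have "x = (minv (1\<^sub>m N - \<Delta> * Pu) * (1\<^sub>m N - \<Delta> * Pu)) *\<^sub>v x"
      unfolding Ri(3) using x by simp
    also have "\<dots> = z"
      unfolding assoc_mult_mat_vec[OF Ri(1) R x] eq z ..
    finally show "x = z" .
  next
    have wc: "w + \<Delta> *\<^sub>v fu \<in> carrier_vec N" using w De fu by auto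
    have "(1\<^sub>m N - \<Delta> * Pu) *\<^sub>v z = w + \<Delta> *\<^sub>v fu"
      unfolding z assoc_mult_mat_vec[OF R Ri(1) wc, symmetric] Ri(2) using wc by simp
    moreover assume "x = z"
    ultimately show "(1\<^sub>m N - \<Delta> * Pu) *\<^sub>v x = w + \<Delta> *\<^sub>v fu" by simp
  qed
  show ?thesis
  proof
    assume H: "y = (Gh + \<Delta>) *\<^sub>v u + w \<and> u = K *\<^sub>v y + p"
    \<comment> \<open>Since \<open>Py\<close> is invertible, any output has the form
      \<open>Py *\<^sub>v x + fy\<close>; this is the preimage of \<open>y\<close>.\<close>
    define x where "x = minv Py *\<^sub>v (y - fy)"
    have x: "x \<in> carrier_vec N" unfolding x_def using Pi y fy by auto
    have yf: "y - fy \<in> carrier_vec N" using y fy by auto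
    have "Py *\<^sub>v x = y - fy"
      unfolding x_def assoc_mult_mat_vec[OF Py Pi(1) yf, symmetric] Pi(2) using yf by simp
    then have y_x: "y = Py *\<^sub>v x + fy" using y fy by (simp only:) (rule eq_vecI, auto)
    \<comment> \<open>Folding \<open>y_x\<close> turns \<open>control\<close> at \<open>x\<close>
      into a statement about \<open>K *\<^sub>v y + p\<close>, which is \<open>u\<close> by
      assumption.\<close>
    have u_x: "u = Pu *\<^sub>v x + fu"
      by (rule trans[OF conjunct2[OF H] control[OF x, folded y_x]])
    have "x = z"
      by (rule iffD1[OF Rz[OF x] iffD1[OF system[OF x, folded y_x u_x] conjunct1[OF H]]])
    then show "y = Py *\<^sub>v z + fy \<and> u = Pu *\<^sub>v z + fu" using y_x u_x by simp
  next
    assume "y = Py *\<^sub>v z + fy \<and> u = Pu *\<^sub>v z + fu"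
    then show "y = (Gh + \<Delta>) *\<^sub>v u + w \<and> u = K *\<^sub>v y + p"
      using control[OF zc] system[OF zc] Rz[OF zc] by simp
  qed
qed

section \<open>The response of the true system\<close>

theorem theorem2:
  fixes n m q T \<tau> :: nat
    and A B C D L G \<Theta> Gh \<Delta> \<Phi>hy \<Phi>hu K \<Phi>y \<Phi>u \<Phi> :: "real mat"
    and u_past y_past y0 \<phi>hy \<phi>hu p \<phi>y \<phi>u \<phi> :: "real vec"
  assumes A: "A \<in> carrier_mat n n"
    and B: "B \<in> carrier_mat n m"
    and C: "C \<in> carrier_mat q n"
    and D: "D \<in> carrier_mat q m"
    and L: "L \<in> carrier_mat n q"
    and u_past: "u_past \<in> carrier_vec (m * \<tau>)"
    and y_past: "y_past \<in> carrier_vec (q * \<tau>)"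
    and G: "G = stacked_G T A B C D"
    and Theta: "\<Theta> = stacked_Theta T A C L"
    and y0: "y0 = predicted_output T \<tau> A B C D L u_past y_past"
    and Gh: "Gh \<in> carrier_mat (q * (T + 1)) (m * (T + 1))"
    and Gh_lower: "block_lower_triangular T q m Gh"
    and Delta: "\<Delta> = G - Gh"
    and Phihy: "\<Phi>hy \<in> carrier_mat (q * (T + 1)) (q * (T + 1))"
    and Phihu: "\<Phi>hu \<in> carrier_mat (m * (T + 1)) (q * (T + 1))"
    and phihy: "\<phi>hy \<in> carrier_vec (q * (T + 1))"
    and phihu: "\<phi>hu \<in> carrier_vec (m * (T + 1))"
    and Phihy_lower: "block_lower_triangular T q q \<Phi>hy"
    and Phihu_strict: "block_strictly_lower_triangular T m q \<Phi>hu"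
    and achievability:
      "append_cols (1\<^sub>m (q * (T + 1))) (- Gh)
         * four_block_mat \<Phi>hy (col_mat \<phi>hy) \<Phi>hu (col_mat \<phi>hu)
       = append_cols (1\<^sub>m (q * (T + 1))) (0\<^sub>m (q * (T + 1)) 1)"
    and K: "K = \<Phi>hu * minv \<Phi>hy"
    and p: "p = \<phi>hu - K *\<^sub>v \<phi>hy"
    and Phiy: "\<Phi>y \<in> carrier_mat (q * (T + 1)) (q * (T + 1))"
    and Phiu: "\<Phi>u \<in> carrier_mat (m * (T + 1)) (q * (T + 1))"
    and phiy: "\<phi>y \<in> carrier_vec (q * (T + 1))"
    and phiu: "\<phi>u \<in> carrier_vec (m * (T + 1))"
    and Phi_blocks: "\<Phi> = \<Phi>y @\<^sub>r \<Phi>u"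
    and Phi: "\<Phi> = (\<Phi>hy @\<^sub>r \<Phi>hu) * minv (1\<^sub>m (q * (T + 1)) - \<Delta> * \<Phi>hu)"
    and phi_blocks: "\<phi> = \<phi>y @\<^sub>v \<phi>u"
    and phi: "\<phi> =
      four_block_mat
        (1\<^sub>m (q * (T + 1)))
        (\<Phi>hy * minv (1\<^sub>m (q * (T + 1)) - \<Delta> * \<Phi>hu) * \<Delta>)
        (0\<^sub>m (m * (T + 1)) (q * (T + 1)))
        (1\<^sub>m (m * (T + 1)) + \<Phi>hu * minv (1\<^sub>m (q * (T + 1)) - \<Delta> * \<Phi>hu) * \<Delta>)
      *\<^sub>v (\<phi>hy @\<^sub>v \<phi>hu)"
  shows "invertible_mat \<Phi>hy \<and>
    invertible_mat (1\<^sub>m (q * (T + 1)) - \<Delta> * \<Phi>hu) \<and>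
    (\<forall>e \<in> carrier_vec (q * (T + 1)).
       (\<exists>!yu. closed_loop_response G y0 \<Theta> K p e (fst yu) (snd yu)) \<and>
       (\<forall>y u. closed_loop_response G y0 \<Theta> K p e y u \<longrightarrow>
          y @\<^sub>v u = \<Phi> *\<^sub>v (y0 + \<Theta> *\<^sub>v e) + \<phi>))"
proof -
  define N M where NM: "N = q * (T + 1)" "M = m * (T + 1)"
  note fold = NM[symmetric]
  note Ghc = Gh[unfolded fold] and Pyc = Phihy[unfolded fold] and Puc = Phihu[unfolded fold]
    and fyc = phihy[unfolded fold] and fuc = phihu[unfolded fold]
  have Gc: "G \<in> carrier_mat N M" unfolding G NM by (rule stacked_G_carrier[OF B C D])
  have Dc: "\<Delta> \<in> carrier_mat N M" unfolding Delta using Gc Ghc by auto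
  have GhD: "G = Gh + \<Delta>" unfolding Delta using Gc Ghc by (intro eq_matI) auto
  have G0: "G $$ (a, b) = 0" if "a < N" "b < M" "a div q < b div m" for a b
    using stacked_G_entry[OF B C D] that unfolding G NM by blast
  have Gh0: "Gh $$ (a, b) = 0" if "a < N" "b < M" "a div q < b div m" for a b
    using block_lower_triangular_entry[OF Gh_lower] that unfolding NM by blast
  \<comment> \<open>\<Delta> is block lower triangular as a difference of two such matrices.\<close>
  have D0: "\<Delta> $$ (a, b) = 0" if "a < N" "b < M" "a div q < b div m" for a b
    using G0[OF that] Gh0[OF that] that Gc Ghc unfolding Delta by simp
  have Pu0: "\<Phi>hu $$ (a, b) = 0" if "a < M" "b < N" "a div m \<le> b div q" for a b
    using block_strictly_lower_triangular_entry[OF Phihu_strict] that unfolding NM by blast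
  have Py_eq: "\<Phi>hy = 1\<^sub>m N + Gh * \<Phi>hu" and fy_eq: "\<phi>hy = Gh *\<^sub>v \<phi>hu"
    using achievability[unfolded fold] achievability_iff[OF Ghc Pyc Puc fyc fuc] by auto

  \<comment> \<open>Block lower times block strictly lower is block strictly lower, here with square
    blocks of size \<open>q\<close>. The same argument with \<Delta> in place of \<open>Gh\<close>
    gives \<open>detR\<close>.\<close>
  have detPy: "det \<Phi>hy = 1"
    unfolding Py_eq
    by (rule det_one_plus_block_strictly_lower[where r = q])
      (use Ghc Puc mult_block_lower_block_strictly_lower_entry[OF Ghc Puc Gh0 Pu0] in auto)
  \<comment> \<open>The determinant lemma concerns a sum; negation preserves the zero
    pattern.\<close>
  have R_eq: "1\<^sub>m N - \<Delta> * \<Phi>hu = 1\<^sub>m N + - (\<Delta> * \<Phi>hu)"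
    using Dc Puc by (intro eq_matI) auto
  have detR: "det (1\<^sub>m N - \<Delta> * \<Phi>hu) = 1"
    unfolding R_eq
    by (rule det_one_plus_block_strictly_lower[where r = q])
      (use Dc Puc mult_block_lower_block_strictly_lower_entry[OF Dc Puc D0 Pu0] in
        \<open>auto simp del: index_mult_mat(1)\<close>)
  have Rc: "1\<^sub>m N - \<Delta> * \<Phi>hu \<in> carrier_mat N N" using Dc Puc by auto
  define R where "R = minv (1\<^sub>m N - \<Delta> * \<Phi>hu)"
  have Ri: "R \<in> carrier_mat N N"
    unfolding R_def by (rule minv_inverse(1)[OF Rc]) (simp add: detR)

  have y0c: "y0 \<in> carrier_vec N"
    unfolding y0 NM predicted_output_def
    by (rule carrier_vecI) (simp add: carrier_matD(1)[OF blkdiag_carrier] carrier_matD(1)[OF C])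
  have Thc: "dim_row \<Theta> = N"
    using C unfolding Theta NM stacked_Theta_def by simp
  have "(\<exists>!yu. closed_loop_response G y0 \<Theta> K p e (fst yu) (snd yu)) \<and>
       (\<forall>y u. closed_loop_response G y0 \<Theta> K p e y u \<longrightarrow>
          y @\<^sub>v u = \<Phi> *\<^sub>v (y0 + \<Theta> *\<^sub>v e) + \<phi>)" for e
  proof -
    define w where "w = y0 + \<Theta> *\<^sub>v e"
    have wc: "w \<in> carrier_vec N" unfolding w_def by (rule carrier_vecI) (simp add: Thc)
    define z where "z = R *\<^sub>v (w + \<Delta> *\<^sub>v \<phi>hu)"
    have zc: "z \<in> carrier_vec N" unfolding z_def using Ri wc Dc fuc by auto
    define ys us where "ys = \<Phi>hy *\<^sub>v z + \<phi>hy" and "us = \<Phi>hu *\<^sub>v z + \<phi>hu"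
    have ysc: "ys \<in> carrier_vec N" and usc: "us \<in> carrier_vec M"
      unfolding ys_def us_def using Pyc Puc fyc fuc zc by auto
    have resp: "closed_loop_response G y0 \<Theta> K p e y u \<longleftrightarrow> y = ys \<and> u = us" for y u
    proof (cases "y \<in> carrier_vec N \<and> u \<in> carrier_vec M")
      case True
      have "G *\<^sub>v u + y0 + \<Theta> *\<^sub>v e = (Gh + \<Delta>) *\<^sub>v u + w"
        unfolding GhD[symmetric] w_def using y0c Gc Thc True
        by (intro eq_vecI) auto
      then show ?thesis
        using closed_loop_iff[OF Ghc Dc Pyc Puc fyc fuc wc _ _ Py_eq fy_eq _ _ K p
            z_def[unfolded R_def], of y u] True Gc
        unfolding closed_loop_response_def ys_def us_def by (simp add: detPy detR)
    \<comment> \<open>Outside the carriers the response predicate fails by definition, while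
      \<open>ys\<close> and \<open>us\<close> lie inside them, so both sides are false.\<close>
    next
      case False
      then show ?thesis
        using ysc usc Gc unfolding closed_loop_response_def by auto
    qed
    have "ys @\<^sub>v us = \<Phi> *\<^sub>v w + \<phi>"
    proof -
      define d where "d = \<Delta> *\<^sub>v \<phi>hu"
      have dc: "d \<in> carrier_vec N" unfolding d_def using Dc fuc by auto
      have Rw: "R *\<^sub>v w \<in> carrier_vec N" and Rd: "R *\<^sub>v d \<in> carrier_vec N" using Ri wc dc by auto
      \<comment> \<open>Linearity separates \<open>R *\<^sub>v w\<close>, which produces the \<Phi>
        term, from \<open>R *\<^sub>v d\<close>, the effect of the model error on the nominal input
        offset, which belongs to \<phi>.\<close>
      have z_eq: "z = R *\<^sub>v w + R *\<^sub>v d"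
        unfolding z_def d_def[symmetric] by (rule mult_add_distrib_mat_vec[OF Ri wc dc])
      have "\<Phi> *\<^sub>v w = (\<Phi>hy @\<^sub>r \<Phi>hu) *\<^sub>v (R *\<^sub>v w)"
        unfolding Phi fold R_def[symmetric]
        by (rule assoc_mult_mat_vec[OF carrier_append_rows[OF Pyc Puc] Ri wc])
      then have Phi_w: "\<Phi> *\<^sub>v w = (\<Phi>hy *\<^sub>v (R *\<^sub>v w)) @\<^sub>v (\<Phi>hu *\<^sub>v (R *\<^sub>v w))"
        using mat_mult_append[OF Pyc Puc Rw] by simp
      have PyRD: "\<Phi>hy * R * \<Delta> \<in> carrier_mat N M" and PuRD: "\<Phi>hu * R * \<Delta> \<in> carrier_mat M M"
        using Pyc Puc Ri Dc by auto
      have Py_d: "(\<Phi>hy * R * \<Delta>) *\<^sub>v \<phi>hu = \<Phi>hy *\<^sub>v (R *\<^sub>v d)"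
        and Pu_d: "(\<Phi>hu * R * \<Delta>) *\<^sub>v \<phi>hu = \<Phi>hu *\<^sub>v (R *\<^sub>v d)"
        using Pyc Puc Ri Dc fuc unfolding d_def by (simp_all add: assoc_mult_mat_vec[of _ _ N _ M])
      have vecs: "\<Phi>hy *\<^sub>v (R *\<^sub>v w) \<in> carrier_vec N" "\<Phi>hu *\<^sub>v (R *\<^sub>v w) \<in> carrier_vec M"
        "\<Phi>hy *\<^sub>v (R *\<^sub>v d) \<in> carrier_vec N" "\<Phi>hu *\<^sub>v (R *\<^sub>v d) \<in> carrier_vec M"
        using Pyc Puc Rw Rd by auto
      have zero: "0\<^sub>m M N *\<^sub>v \<phi>hy = 0\<^sub>v M"
        using fyc by (intro eq_vecI) auto
      \<comment> \<open>The identity blocks return the nominal offsets, and the remaining blocks,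
        containing \<open>R * \<Delta>\<close>, act on \<open>\<phi>hu\<close> to give the
        contribution of \<open>R *\<^sub>v d\<close>.\<close>
      have phi_eq: "\<phi> = (\<phi>hy + \<Phi>hy *\<^sub>v (R *\<^sub>v d)) @\<^sub>v (\<phi>hu + \<Phi>hu *\<^sub>v (R *\<^sub>v d))"
        unfolding phi fold R_def[symmetric]
        by (subst four_block_mat_mult_vec[of _ N N _ M _ M])
          (use PyRD PuRD fyc fuc vecs in \<open>simp_all add: zero Py_d Pu_d
            add_mult_distrib_mat_vec[OF one_carrier_mat PuRD fuc]\<close>)
      show ?thesis
        unfolding Phi_w phi_eq ys_def us_def z_eq mult_add_distrib_mat_vec[OF Pyc Rw Rd]
          mult_add_distrib_mat_vec[OF Puc Rw Rd]
        by (subst append_vec_add[of _ N _ _ M])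
          (use fyc fuc vecs in \<open>auto simp: comm_add_vec[OF fyc] comm_add_vec[OF fuc]\<close>)
    qed
    \<comment> \<open>By \<open>resp\<close> the responses are exactly the single pair
      \<open>(ys, us)\<close>, so unique existence holds and the formula is not vacuous.\<close>
    then show ?thesis
      unfolding resp w_def by auto
  qed
  \<comment> \<open>Invertibility belongs to the conclusion because \<open>minv\<close> carries no
    information at singular matrices.\<close>
  then show ?thesis
    using invertible_mat_if_det_nonzero[OF Pyc] invertible_mat_if_det_nonzero[OF Rc] detPy detR
    unfolding fold by simp
qed

end
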